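(* For all integers $n\ge 0$, $$(2n+1)B_{2n}=\sum_{j=0}^{n}(-1)^j\frac{(j!)^2}{j+1}\,T(n+1,j+1).$$
   Context: The Bernoulli numbers $B_n$ are defined by $\sum_{n\ge0}B_n\frac{z^n}{n!}=\frac{z}{e^z-1}$. The central factorial numbers of the second kind $T(n,k)$, $n,k\ge0$, are defined by $T(0,0)=1$, $T(0,k)=0$ for $k\ge1$, $T(n,0)=0$ for $n\ge1$, and $T(n,k)=T(n-1,k-1)+k^2T(n-1,k)$ for $n,k\ge 1$. *)

theory Defs
  imports Complex_Main "HOL-Computational_Algebra.Formal_Power_Series"
begin

text \<open>The divisor \<open>fps_exp 1 - 1\<close> has subdegree 1, as has \<open>fps_X\<close>, so the quotient is exact
  in the ring of formal power series.\<close>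

definition bernoulli :: "nat \<Rightarrow> rat" where
  "bernoulli n = fact n * fps_nth (fps_X / (fps_exp 1 - 1)) n"

fun central_factorial2 :: "nat \<Rightarrow> nat \<Rightarrow> nat" where
  "central_factorial2 0 0 = 1"
| "central_factorial2 0 (Suc k) = 0"
| "central_factorial2 (Suc n) 0 = 0"
| "central_factorial2 (Suc n) (Suc k) =
     central_factorial2 n k + (Suc k)\<^sup>2 * central_factorial2 n (Suc k)"

lemma bernoulli_gen_fun:
  "Abs_fps (\<lambda>n. bernoulli n / fact n) * (fps_exp 1 - 1) = fps_X"
proof -
  have nz: "fps_exp 1 - 1 \<noteq> (0 :: rat fps)"
  proof
    assume "fps_exp 1 - 1 = (0 :: rat fps)"
    then have "fps_nth (fps_exp 1 - 1 :: rat fps) 1 = fps_nth 0 1" by (rule arg_cong)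
    then show False by simp
  qed
  have sd: "subdegree (fps_exp 1 - 1 :: rat fps) = 1"
    by (rule subdegreeI) simp_all
  have "Abs_fps (\<lambda>n. bernoulli n / fact n) = fps_X / (fps_exp 1 - 1 :: rat fps)"
    by (rule fps_ext) (simp add: bernoulli_def)
  moreover have "(fps_exp 1 - 1 :: rat fps) dvd fps_X"
    using nz sd by (simp add: fps_dvd_iff)
  ultimately show ?thesis by simp
qed

end

theory Submission
  imports Defs "HOL-Computational_Algebra.Polynomial"
begin

text \<open>Let \<open>L\<close> be the umbral functional \<open>x\<^sup>k \<mapsto> B\<^sub>k\<close> on polynomials, so that
  \<open>L (p (x + 1) - p x) = p' 0\<close>. If \<open>F (x + 1) - F x = x\<^bsup>2n+1\<^esup>\<close>, then applying \<open>L\<close> to the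
  derivative of this equation yields \<open>(2n + 1) B\<^bsub>2n\<^esub> = F'' 0\<close>. Such an \<open>F\<close> comes from the expansion
  of \<open>x\<^bsup>2n+1\<^esup>\<close> in the odd central factorials \<open>P\<^sub>j = x (x\<^sup>2 - 1\<^sup>2) \<cdots> (x\<^sup>2 - j\<^sup>2)\<close>, whose coefficients
  are \<open>T(n + 1, j + 1)\<close>: the polynomial \<open>(x - j - 1) P\<^sub>j\<close> has difference \<open>(2j + 2) P\<^sub>j\<close>
  and quadratic coefficient \<open>(-1)\<^sup>j (j!)\<^sup>2\<close>.\<close>

text \<open>Compare coefficients of z^k in the generating function identity and multiply by k!. The
  term i = k drops out because e^z - 1 has no constant term.\<close>

lemma bernoulli_recurrence:
  "(\<Sum>i<k. of_nat (k choose i) * bernoulli i) = (if k = 1 then 1 else 0)"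
proof -
  have "fps_nth (Abs_fps (\<lambda>n. bernoulli n / fact n) * (fps_exp 1 - 1)) k
      = (\<Sum>i=0..k. bernoulli i / fact i * fps_nth (fps_exp 1 - 1) (k - i))"
    by (simp add: fps_mult_nth)
  also have "\<dots> = (\<Sum>i<k. bernoulli i / fact i * fps_nth (fps_exp 1 - 1) (k - i))"
    by (rule sum.mono_neutral_right) auto
  also have "\<dots> = (\<Sum>i<k. of_nat (k choose i) * bernoulli i) / fact k"
    unfolding sum_divide_distrib
    by (rule sum.cong) (auto simp: binomial_fact field_simps)
  finally show ?thesis
    unfolding bernoulli_gen_fun by (auto simp: field_simps split: if_splits)
qed

definition bernoulli_umbral :: "rat poly \<Rightarrow> rat" where
  "bernoulli_umbral p = (\<Sum>i\<le>degree p. coeff p i * bernoulli i)"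

text \<open>A common degree bound makes additivity immediate even when leading terms cancel.\<close>

lemma bernoulli_umbral_eq:
  assumes "degree p \<le> N"
  shows "bernoulli_umbral p = (\<Sum>i\<le>N. coeff p i * bernoulli i)"
  unfolding bernoulli_umbral_def
  by (rule sum.mono_neutral_left) (use assms in \<open>auto simp: coeff_eq_0\<close>)

lemma bernoulli_umbral_add:
  "bernoulli_umbral (p + q) = bernoulli_umbral p + bernoulli_umbral q"
proof -
  let ?N = "max (degree p) (degree q)"
  have "bernoulli_umbral r = (\<Sum>i\<le>?N. coeff r i * bernoulli i)" if "r \<in> {p, q, p + q}" for r
    by (rule bernoulli_umbral_eq) (use that degree_add_le_max[of p q] in auto)
  then show ?thesis
    by (simp add: sum.distrib algebra_simps)
qed

text \<open>For x^k the difference is the binomial sum over i < k, which the Bernoulli recurrence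
  evaluates; additivity does the rest.\<close>

lemma bernoulli_umbral_shift:
  "bernoulli_umbral (pcompose p [:1, 1:] - p) = coeff p 1"
proof -
  have monom: "bernoulli_umbral (pcompose (monom c k) [:1, 1:] - monom c k)
      = coeff (monom c k) 1" for c :: rat and k
  proof -
    let ?q = "pcompose (monom c k) [:1, 1:] - monom c k"
    have "pcompose ([:0, 1:] ^ k) [:1, 1:] = ([:1, 1:] :: rat poly) ^ k"
      by (induction k) (simp_all add: pcompose_mult pcompose_pCons pcompose_1)
    then have comp: "pcompose (monom c k) [:1, 1:] = smult c ([:1, 1:] ^ k)"
      by (simp add: monom_altdef pcompose_smult)
    have coeff: "coeff ?q i = (if i < k then c * of_nat (k choose i) else 0)" for i
      by (cases "i \<le> k")
        (auto simp: comp coeff_linear_poly_power coeff_eq_0 degree_linear_power)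
    have "degree ?q \<le> k"
      by (rule degree_le) (simp add: coeff del: coeff_diff)
    then have "bernoulli_umbral ?q = (\<Sum>i\<le>k. coeff ?q i * bernoulli i)"
      by (rule bernoulli_umbral_eq)
    also have "\<dots> = (\<Sum>i<k. c * of_nat (k choose i) * bernoulli i)"
      unfolding coeff by (rule sum.mono_neutral_cong_right) auto
    also have "\<dots> = c * (\<Sum>i<k. of_nat (k choose i) * bernoulli i)"
      by (simp add: sum_distrib_left mult.assoc)
    finally show ?thesis
      by (simp add: bernoulli_recurrence)
  qed
  \<comment> \<open>Scalars sit inside the monomials, so additivity carries the claim to finite
    sums.\<close>
  have "bernoulli_umbral (pcompose (\<Sum>i\<in>A. monom (coeff p i) i) [:1, 1:]
      - (\<Sum>i\<in>A. monom (coeff p i) i)) = coeff (\<Sum>i\<in>A. monom (coeff p i) i) 1"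
    if "finite A" for A
    using that
  proof (induction A rule: finite_induct)
    case empty
    show ?case by (simp add: bernoulli_umbral_def)
  next
    case (insert k A)
    let ?S = "\<Sum>i\<in>A. monom (coeff p i) i"
    have "pcompose (monom (coeff p k) k + ?S) [:1, 1:] - (monom (coeff p k) k + ?S)
        = (pcompose (monom (coeff p k) k) [:1, 1:] - monom (coeff p k) k)
          + (pcompose ?S [:1, 1:] - ?S)"
      by (simp add: pcompose_add)
    then show ?case
      using insert by (simp only: sum.insert bernoulli_umbral_add monom coeff_add not_False_eq_True)
  qed
  from this[of "{..degree p}"] show ?thesis
    by (simp add: poly_as_sum_of_monoms)
qed

text \<open>Differentiation commutes with the shift, so F' has difference (m + 1) x^m, and the
  linear coefficient of F' is twice the quadratic one of F.\<close>

lemma coeff_2_of_difference_monom: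
  assumes "pcompose F [:1, 1:] - F = monom 1 (Suc m)"
  shows "2 * coeff F 2 = of_nat (Suc m) * bernoulli m"
proof -
  have "pcompose (pderiv F) [:1, 1:] - pderiv F = pderiv (pcompose F [:1, 1:] - F)"
    by (simp add: pderiv_pcompose pderiv_diff pderiv_pCons)
  also have "\<dots> = monom (of_nat (Suc m)) m"
    by (simp add: assms pderiv_monom)
  finally have "coeff (pderiv F) 1 = bernoulli_umbral (monom (of_nat (Suc m)) m)"
    by (metis bernoulli_umbral_shift)
  also have "\<dots> = (\<Sum>i\<le>m. coeff (monom (of_nat (Suc m)) m) i * bernoulli i)"
    by (rule bernoulli_umbral_eq) (rule degree_monom_le)
  also have "\<dots> = of_nat (Suc m) * bernoulli m"
    by (simp add: if_distrib[of "\<lambda>x. x * _"] cong: if_cong)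
  finally show ?thesis
    by (simp add: coeff_pderiv numeral_2_eq_2)
qed

fun odd_central_factorial :: "nat \<Rightarrow> rat poly" where
  "odd_central_factorial 0 = [:0, 1:]"
| "odd_central_factorial (Suc j) = odd_central_factorial j * [:- (of_nat (Suc j))\<^sup>2, 0, 1:]"

lemma coeff_odd_central_factorial:
  "coeff (odd_central_factorial j) 0 = 0"
  "coeff (odd_central_factorial j) 1 = (- 1) ^ j * (fact j)\<^sup>2"
  "coeff (odd_central_factorial j) 2 = 0"
  by (induction j) (simp_all add: coeff_mult numeral_2_eq_2 power_mult_distrib algebra_simps)

text \<open>\<open>odd_central_factorial j\<close> is the product (x - j) ... (x + j). Shifting x by
  1 drops the factor x - j and gains x + j + 1; the identity is stated free of division.\<close>

lemma pcompose_odd_central_factorial: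
  "[:- of_nat j, 1:] * pcompose (odd_central_factorial j) [:1, 1:]
    = [:of_nat (Suc j), 1:] * odd_central_factorial j"
proof (induction j)
  case 0
  show ?case by (simp add: pcompose_pCons)
next
  case (Suc j)
  let ?Q = "pcompose (odd_central_factorial j) [:1, 1:]"
  \<comment> \<open>(x + 1)^2 - (j + 1)^2 = (x - j) (x + j + 2) supplies the factor x - j that the
    induction hypothesis absorbs.\<close>
  have "pcompose [:- (of_nat (Suc j))\<^sup>2, 0, 1:] [:1, 1:]
      = [:- of_nat j, 1:] * [:of_nat (Suc (Suc j)), 1 :: rat:]"
    by (simp add: pcompose_pCons power2_eq_square algebra_simps)
  then have "[:- of_nat (Suc j), 1:] * pcompose (odd_central_factorial (Suc j)) [:1, 1:]
      = [:- of_nat (Suc j), 1:] * [:of_nat (Suc (Suc j)), 1:] * ([:- of_nat j, 1:] * ?Q)"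
    by (simp only: odd_central_factorial.simps pcompose_mult mult_ac)
  also have "\<dots> = [:of_nat (Suc (Suc j)), 1:]
      * (odd_central_factorial j * ([:- of_nat (Suc j), 1:] * [:of_nat (Suc j), 1:]))"
    by (simp only: Suc.IH mult_ac)
  also have "[:- of_nat (Suc j), 1:] * [:of_nat (Suc j), 1:]
      = [:- (of_nat (Suc j))\<^sup>2, 0, 1 :: rat:]"
    by (simp add: power2_eq_square algebra_simps)
  finally show ?case by simp
qed

text \<open>The shift turns x - j - 1 into x - j, the multiplier in the preceding shift identity.
  Hence \<open>G\<close> and its shift are both linear multiples of the same
  \<open>odd_central_factorial j\<close>.\<close>

lemma difference_odd_central_factorial:
  fixes j :: nat
  defines "G \<equiv> [:- of_nat (Suc j), 1:] * odd_central_factorial j"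
  shows "pcompose G [:1, 1:] - G = smult (of_nat (2 * j + 2)) (odd_central_factorial j)"
proof -
  have "pcompose [:- of_nat (Suc j), 1:] [:1, 1:] = [:- of_nat j, 1 :: rat:]"
    by (simp add: pcompose_pCons)
  then have "pcompose G [:1, 1:] = [:of_nat (Suc j), 1:] * odd_central_factorial j"
    by (simp only: G_def pcompose_mult pcompose_odd_central_factorial)
  then have "pcompose G [:1, 1:] - G
      = ([:of_nat (Suc j), 1:] - [:- of_nat (Suc j), 1:]) * odd_central_factorial j"
    by (simp only: G_def left_diff_distrib)
  also have "[:of_nat (Suc j), 1:] - [:- of_nat (Suc j), 1:] = [:of_nat (2 * j + 2) :: rat:]"
    by simp
  finally show ?thesis by simp
qed

lemma coeff_2_difference_odd_central_factorial:
  "coeff ([:- of_nat (Suc j), 1:] * odd_central_factorial j) 2 = (- 1) ^ j * (fact j)\<^sup>2"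
  using coeff_odd_central_factorial[of j] by (simp add: numeral_2_eq_2)

lemma central_factorial2_eq_0: "n < k \<Longrightarrow> central_factorial2 n k = 0"
  by (induction n k rule: central_factorial2.induct) auto

text \<open>Multiplication by x^2 = (x^2 - (j + 1)^2) + (j + 1)^2 reproduces the recurrence of the
  central factorial numbers.\<close>

lemma monom_eq_sum_odd_central_factorial:
  "monom 1 (2 * n + 1) = (\<Sum>j\<le>n. smult (of_nat (central_factorial2 (Suc n) (Suc j)))
      (odd_central_factorial j))"
proof (induction n)
  case 0
  show ?case by (simp add: monom_altdef)
next
  case (Suc n)
  let ?T = "\<lambda>k. of_nat (central_factorial2 (Suc n) k) :: rat" and ?P = odd_central_factorial
  have step: "monom 1 2 * ?P j = ?P (Suc j) + smult ((of_nat (Suc j))\<^sup>2) (?P j)" for j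
  proof -
    have "monom 1 2 = [:- (of_nat (Suc j))\<^sup>2, 0, 1:] + [:(of_nat (Suc j))\<^sup>2 :: rat:]"
      by (simp add: monom_altdef numeral_2_eq_2)
    then show ?thesis by (simp add: algebra_simps)
  qed
  have "monom 1 (2 * Suc n + 1) = monom 1 2 * (monom 1 (2 * n + 1) :: rat poly)"
    by (simp add: mult_monom)
  also have "\<dots> = (\<Sum>j\<le>n. smult (?T (Suc j)) (?P (Suc j)))
      + (\<Sum>j\<le>n. smult ((of_nat (Suc j))\<^sup>2 * ?T (Suc j)) (?P j))"
    unfolding Suc.IH sum_distrib_left sum.distrib[symmetric]
    by (rule sum.cong) (simp_all only: mult_smult_right step smult_add_right smult_smult
        mult.commute[of "?T _"])
  \<comment> \<open>Reindexing adds a term at j = 0, which vanishes as T(n + 1, 0) = 0.\<close>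
  also have "(\<Sum>j\<le>n. smult (?T (Suc j)) (?P (Suc j)))
      = (\<Sum>j\<le>Suc n. smult (?T j) (?P j))"
    by (simp add: sum.atMost_Suc_shift del: odd_central_factorial.simps sum.atMost_Suc)
  \<comment> \<open>The added top term vanishes as T(n + 1, n + 2) = 0.\<close>
  also have "(\<Sum>j\<le>n. smult ((of_nat (Suc j))\<^sup>2 * ?T (Suc j)) (?P j))
      = (\<Sum>j\<le>Suc n. smult ((of_nat (Suc j))\<^sup>2 * ?T (Suc j)) (?P j))"
    by (simp add: central_factorial2_eq_0 del: central_factorial2.simps)
  also have "(\<Sum>j\<le>Suc n. smult (?T j) (?P j))
      + (\<Sum>j\<le>Suc n. smult ((of_nat (Suc j))\<^sup>2 * ?T (Suc j)) (?P j))
      = (\<Sum>j\<le>Suc n. smult (of_nat (central_factorial2 (Suc (Suc n)) (Suc j))) (?P j))"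
    unfolding sum.distrib[symmetric] smult_add_left[symmetric]
    by (simp only: central_factorial2.simps(4)[of "Suc n"] of_nat_add of_nat_mult of_nat_power)
  finally show ?case .
qed

theorem mainTheorem5:
  fixes n :: nat
  shows "of_nat (2 * n + 1) * bernoulli (2 * n) =
    (\<Sum>j = 0..n. (- 1) ^ j * (fact j)\<^sup>2 / of_nat (j + 1)
        * of_nat (central_factorial2 (n + 1) (j + 1)))"
proof -
  let ?T = "\<lambda>j. of_nat (central_factorial2 (Suc n) (Suc j)) :: rat"
  let ?G = "\<lambda>j. [:- of_nat (Suc j), 1:] * odd_central_factorial j"
  \<comment> \<open>Dividing by 2j + 2 normalises the difference of each \<open>?G j\<close> to
    \<open>odd_central_factorial j\<close>.\<close>
  define F where "F = (\<Sum>j\<le>n. smult (?T j / of_nat (2 * j + 2)) (?G j))"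
  have "pcompose F [:1, 1:] - F
      = (\<Sum>j\<le>n. smult (?T j / of_nat (2 * j + 2)) (pcompose (?G j) [:1, 1:] - ?G j))"
    by (simp only: F_def pcompose_sum pcompose_smult smult_diff_right sum_subtractf)
  also have "\<dots> = (\<Sum>j\<le>n. smult (?T j) (odd_central_factorial j))"
  proof (rule sum.cong)
    fix j
    have "rat_of_nat (2 * j + 2) \<noteq> 0"
      unfolding of_nat_eq_0_iff by simp
    then have "?T j / of_nat (2 * j + 2) * of_nat (2 * j + 2) = ?T j"
      by (rule nonzero_eq_divide_eq[THEN iffD1, OF _ refl])
    then show "smult (?T j / of_nat (2 * j + 2)) (pcompose (?G j) [:1, 1:] - ?G j)
        = smult (?T j) (odd_central_factorial j)"
      by (simp only: difference_odd_central_factorial smult_smult)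
  qed simp
  also have "\<dots> = monom 1 (Suc (2 * n))"
    using monom_eq_sum_odd_central_factorial[of n] by simp
  finally have "of_nat (Suc (2 * n)) * bernoulli (2 * n) = 2 * coeff F 2"
    using coeff_2_of_difference_monom by metis
  also have "\<dots> = (\<Sum>j\<le>n. 2 * (?T j / of_nat (2 * j + 2) * ((- 1) ^ j * (fact j)\<^sup>2)))"
    by (simp only: F_def coeff_sum coeff_smult coeff_2_difference_odd_central_factorial
        sum_distrib_left)
  \<comment> \<open>The 2 from the second derivative at 0 cancels in 2j + 2, leaving the denominator
    j + 1.\<close>
  also have "\<dots> = (\<Sum>j\<le>n. (- 1) ^ j * (fact j)\<^sup>2 / of_nat (j + 1) * ?T j)"
  proof (rule sum.cong)
    fix j
    have "of_nat (2 * j + 2) = 2 * (of_nat (j + 1) :: rat)"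
      by simp
    moreover have "2 * (a / (2 * b) * c) = c / b * a" for a b c :: rat
      by simp
    ultimately show "2 * (?T j / of_nat (2 * j + 2) * ((- 1) ^ j * (fact j)\<^sup>2))
        = (- 1) ^ j * (fact j)\<^sup>2 / of_nat (j + 1) * ?T j"
      by (simp only:)
  qed simp
  finally show ?thesis
    by (simp add: atMost_atLeast0)
qed

end
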